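(* Let $L$ be an oriented virtual link diagram, let $G_L$ be the signed ribbon graph associated with $L$ (constructed from the Seifert state of $L$ as described in the context), and let $n:=n(G_L)$, $r:=r(G_L)$, $k:=k(G_L)$ be the nullity, the rank and the number of connected components of $G_L$. Let $[L](A,B,d)$ denote the three-variable Kauffman bracket of $L$ and let $R_{G_L}(x,y,z)$ denote the signed Bollobás–Riordan polynomial of $G_L$. Then $$[L](A,B,d) = A^{n} B^{r} d^{\,k-1}\, R_{G_L}\!\left(\frac{Ad}{B},\ \frac{Bd}{A},\ \frac{1}{d}\right).$$
   Context: **Virtual link diagrams.** A virtual link diagram is a planar diagram like an ordinary link diagram (generically immersed closed curves in the plane with transverse double points), except that each double point is designated either as a classical crossing (with over/under information) or as a virtual crossing (no over/under information). Virtual crossings are artifacts of the planar picture: curves simply pass through them, and they do not connect components. **Splittings and states.** At a classical crossing, the $A$-splitting is the resolution obtained by joining the two vertical angles swept out by the overcrossing arc when it is rotated counterclockwise toward the undercrossing arc; the $B$-splitting is obtained by joining the other two vertical angles. A state $S$ of $L$ is a choice of either an $A$- or a $B$-splitting at each classical crossing; $\mathcal{S}(L)$ is the set of all states. For a state $S$, $\alpha(S)$ and $\beta(S)$ are the numbers of $A$-splittings and $B$-splittings in $S$, and $\delta(S)$ is the number of components (closed curves, passing straight through virtual crossings) of the curve obtained from $L$ by splitting according to $S$. **Kauffman bracket.** $$[L](A,B,d) := \sum_{S\in\mathcal{S}(L)} A^{\alpha(S)} B^{\beta(S)} d^{\,\delta(S)-1}.$$ **Signed ribbon graphs.** A signed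 ribbon graph $G$ is a surface (possibly nonorientable) with boundary represented as the union of two sets of closed topological discs, called vertices $V(G)$ and edges $E(G)$, such that: vertices and edges intersect in disjoint line segments; each such segment lies on the boundary of precisely one vertex and precisely one edge; every edge contains exactly two such segments; together with a sign function $\varepsilon:E(G)\to\{\pm1\}$. Put $v(G)=|V(G)|$, $e(G)=|E(G)|$; $k(G)$ is the number of connected components of $G$; $r(G)=v(G)-k(G)$ is the rank; $n(G)=e(G)-r(G)$ is the nullity; $\mathrm{bc}(G)$ is the number of connected components of the boundary of the surface $G$. A spanning subgraph of $G$ consists of all vertices of $G$ and a subset of the edges; $\mathcal{F}(G)$ is the set of spanning subgraphs. For $F\in\mathcal{F}(G)$, $e_-(F)$ is the number of edges of $F$ with sign $-1$, $\overline{F}$ is the spanning subgraph whose edges are exactly the edges of $G$ not in $F$, and $$s(F)=\frac{e_-(F)-e_-(\overline F)}{2}.$$ **Signed Bollobás–Riordan polynomial.** $$R_G(x,y,z) := \sum_{F\in\mathcal{F}(G)} x^{r(G)-r(F)+s(F)}\, y^{n(F)-s(F)}\, z^{k(F)-\mathrm{bc}(F)+n(F)},$$ a Laurent polynomial in $x^{1/2},y^{1/2},z$. When substituting $x=Ad/B$, $y=Bd/A$, half-integer powers are computed formally: $x^{1/2}=A^{1/2}d^{1/2}B^{-1/2}$, $y^{1/2}=B^{1/2}d^{1/2}A^{-1/2}$. **The ribbon graph $G_L$.** Let $L$ be an oriented virtual link diagram. The Seifert state of $L$ is the state in which every splitting is the one preserving the orientation (the Seifert splitting); its state circles are called Seifert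 circles and inherit orientations from $L$. The vertices of $G_L$ are discs, one glued to each Seifert circle (each Seifert circle being the boundary of its abstract vertex-disc, regardless of self-intersections of the circle at virtual crossings in the plane). The edges of $G_L$ correspond bijectively to the classical crossings of $L$: at each classical crossing one places a small planar (untwisted) band connecting the two branches of the Seifert splitting. Only the resulting abstract surface matters, not any embedding in 3-space. Equivalently: mark on the Seifert circles the places where the bands attach, in their order along the oriented circles; draw each Seifert circle separately as a round circle in the plane oriented counterclockwise and bounding a disc; and attach for each crossing a band at its two marks with a half-twist. Explicitly, the band is a rectangle $[0,1]\times[0,1]$ whose sides $\{0\}\times[0,1]$ and $\{1\}\times[0,1]$ are glued to the two marked arcs so that the orientations of both arcs (inherited from the Seifert circles) correspond to the increasing direction of the second coordinate. The sign of an edge is $+1$ if the Seifert splitting at the corresponding crossing is an $A$-splitting and $-1$ if it is a $B$-splitting. *)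

theory Defs
  imports
    Complex_Main
    "HOL-Library.Poly_Mapping"
    "HOL-Library.Product_Plus"
    "HOL-Library.Numeral_Type"
    "HOL-Library.FuncSet"
begin

section \<open>Laurent polynomials in three variables with rational exponents\<close>

text \<open>
  \<open>Poly_Mapping\<close> gives the group ring of the exponent group \<open>\<rat>\<^sup>3\<close>. Since exponents are rational,
  half-integer powers of the variables are available as formal objects.
\<close>

type_synonym exponent = "rat \<times> rat \<times> rat"
type_synonym laurent = "exponent \<Rightarrow>\<^sub>0 int"

definition monom3 :: "rat \<Rightarrow> rat \<Rightarrow> rat \<Rightarrow> laurent" where
  "monom3 p q t = Poly_Mapping.single (p, q, t) 1"

definition scale_exponent :: "rat \<Rightarrow> exponent \<Rightarrow> exponent" where
  "scale_exponent c = (\<lambda>(p, q, t). (c * p, c * q, c * t))"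

text \<open>
  \<open>subst_monomials X Y Z P\<close> substitutes for the three variables of \<open>P\<close> the monomials (with
  coefficient 1) having exponent vectors \<open>X\<close>, \<open>Y\<close>, \<open>Z\<close>. Rational powers of a monomial are formal:
  the exponent vector is scaled.
\<close>

definition subst_monomials :: "exponent \<Rightarrow> exponent \<Rightarrow> exponent \<Rightarrow> laurent \<Rightarrow> laurent" where
  "subst_monomials X Y Z P =
     (\<Sum>(p, q, t)\<in>Poly_Mapping.keys P.
        Poly_Mapping.single (scale_exponent p X + scale_exponent q Y + scale_exponent t Z)
          (Poly_Mapping.lookup P (p, q, t)))"

text \<open>Exponent vectors of the variables \<open>A\<close>, \<open>B\<close>, \<open>d\<close>.\<close>

definition exp_A :: exponent where "exp_A = (1, 0, 0)"
definition exp_B :: exponent where "exp_B = (0, 1, 0)"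
definition exp_d :: exponent where "exp_d = (0, 0, 1)"


section \<open>Connected components\<close>

text \<open>Classes of \<open>X\<close> under the equivalence relation generated by a relation \<open>R\<close> on \<open>X\<close>.\<close>

definition components :: "'a set \<Rightarrow> ('a \<times> 'a) set \<Rightarrow> 'a set set" where
  "components X R = X // (R \<union> R\<inverse>)\<^sup>*"


section \<open>Signed ribbon graphs\<close>

text \<open>
  The boundary circles of the vertex-discs are oriented and subdivided into finitely many arcs;
  \<open>next_arc a\<close> is the arc following \<open>a\<close> on its circle, so a vertex is a cycle of \<open>next_arc\<close>.
  A subdivision point is named by the arc starting there: \<open>a\<close> runs from point \<open>a\<close> to
  point \<open>next_arc a\<close>. A circle may consist of a single closed arc.

  An edge \<open>e\<close> is a rectangle \<open>[0,1] \<times> [0,1]\<close> with \<open>{0} \<times> [0,1]\<close> glued to the arc \<open>attach e False\<close>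
  and \<open>{1} \<times> [0,1]\<close> to the arc \<open>attach e True\<close>. If \<open>coherent e\<close>, both arcs run in the
  direction of increasing second coordinate, otherwise only the arc \<open>attach e False\<close> does.
  Thus a coherent edge between two distinct discs drawn counterclockwise in the plane
  is a half-twisted band. Not all arcs have to be used by edges, so a spanning subgraph
  keeps all arcs and merely has fewer edges.
\<close>

record ('a, 'e) ribbon_graph =
  arcs :: "'a set"
  next_arc :: "'a \<Rightarrow> 'a"
  edges :: "'e set"
  attach :: "'e \<Rightarrow> bool \<Rightarrow> 'a"
  coherent :: "'e \<Rightarrow> bool"
  edge_sign :: "'e \<Rightarrow> int"

definition attached_arcs :: "('a, 'e) ribbon_graph \<Rightarrow> 'a set" where
  "attached_arcs G = (\<Union>e\<in>edges G. range (attach G e))"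

text \<open>The last but one condition says that the closed attaching segments are disjoint:
  attached arcs are never consecutive.\<close>

definition signed_ribbon_graph :: "('a, 'e) ribbon_graph \<Rightarrow> bool" where
  "signed_ribbon_graph G \<longleftrightarrow>
     finite (arcs G) \<and> finite (edges G) \<and>
     bij_betw (next_arc G) (arcs G) (arcs G) \<and>
     attached_arcs G \<subseteq> arcs G \<and>
     inj_on (\<lambda>(e, b). attach G e b) (edges G \<times> UNIV) \<and>
     (\<forall>a\<in>attached_arcs G. next_arc G a \<notin> attached_arcs G) \<and>
     (\<forall>e\<in>edges G. edge_sign G e \<in> {1, -1})"

definition vertices :: "('a, 'e) ribbon_graph \<Rightarrow> 'a set set" where
  "vertices G = components (arcs G) {(a, next_arc G a) | a. a \<in> arcs G}"

definition num_components :: "('a, 'e) ribbon_graph \<Rightarrow> int" where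
  "num_components G =
     int (card (components (vertices G)
       {(u, w). u \<in> vertices G \<and> w \<in> vertices G \<and>
                (\<exists>e\<in>edges G. attach G e False \<in> u \<and> attach G e True \<in> w)}))"

definition rank :: "('a, 'e) ribbon_graph \<Rightarrow> int" where
  "rank G = int (card (vertices G)) - num_components G"

definition nullity :: "('a, 'e) ribbon_graph \<Rightarrow> int" where
  "nullity G = int (card (edges G)) - rank G"

text \<open>
  The boundary of the surface is the union of the arcs to which no edge is glued and of the two
  sides \<open>[0,1] \<times> {0}\<close> and \<open>[0,1] \<times> {1}\<close> of every edge. It is described by the pairs of end points
  of these pieces. As attached arcs are not consecutive, every subdivision point
  lies on the boundary.
\<close>

definition edge_sides :: "('a, 'e) ribbon_graph \<Rightarrow> 'e \<Rightarrow> ('a \<times> 'a) set" where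
  "edge_sides G e =
     (let a = attach G e False; b = attach G e True in
      if coherent G e then {(a, b), (next_arc G a, next_arc G b)}
      else {(a, next_arc G b), (next_arc G a, b)})"

definition boundary_pieces :: "('a, 'e) ribbon_graph \<Rightarrow> ('a \<times> 'a) set" where
  "boundary_pieces G =
     {(a, next_arc G a) | a. a \<in> arcs G - attached_arcs G} \<union> (\<Union>e\<in>edges G. edge_sides G e)"

definition bc :: "('a, 'e) ribbon_graph \<Rightarrow> int" where
  "bc G = int (card (components (arcs G) (boundary_pieces G)))"

definition spanning_subgraphs :: "('a, 'e) ribbon_graph \<Rightarrow> ('a, 'e) ribbon_graph set" where
  "spanning_subgraphs G = {G\<lparr>edges := E\<rparr> | E. E \<subseteq> edges G}"

definition complement_subgraph ::
  "('a, 'e) ribbon_graph \<Rightarrow> ('a, 'e) ribbon_graph \<Rightarrow> ('a, 'e) ribbon_graph" where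
  "complement_subgraph G F = G\<lparr>edges := edges G - edges F\<rparr>"

definition e_minus :: "('a, 'e) ribbon_graph \<Rightarrow> nat" where
  "e_minus F = card {e \<in> edges F. edge_sign F e = -1}"

definition s_value :: "('a, 'e) ribbon_graph \<Rightarrow> ('a, 'e) ribbon_graph \<Rightarrow> rat" where
  "s_value G F = (of_nat (e_minus F) - of_nat (e_minus (complement_subgraph G F))) / 2"

definition BR_poly :: "('a, 'e) ribbon_graph \<Rightarrow> laurent" where
  "BR_poly G =
     (\<Sum>F\<in>spanning_subgraphs G.
        monom3 (of_int (rank G - rank F) + s_value G F)
               (of_int (nullity F) - s_value G F)
               (of_int (num_components F - bc F + nullity F)))"


section \<open>Oriented virtual link diagrams\<close>

text \<open>
  A diagram is given by its double points (classical and virtual), the arcs of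
  the underlying 4-valent plane graph, and the components without double points (\<open>loops\<close>). The
  orientation of the latter and the relative position of the connected components of
  the diagram in the plane are not recorded.
  The four ends of arcs at a double point \<open>c\<close> are \<open>(c, 0)\<close>, \<open>(c, 1)\<close>, \<open>(c, 2)\<close>, \<open>(c, 3)\<close> in
  counterclockwise order (indices modulo 4). At a classical crossing the overcrossing branch
  occupies \<open>(c, 0)\<close> and \<open>(c, 2)\<close>; at a virtual crossing the choice of \<open>(c, 0)\<close> is irrelevant.
  The function \<open>opp_end\<close> sends an end of an arc to the other end of that arc, and \<open>outgoing\<close>
  consists of the ends at which the orientation of the link leaves the double point.
\<close>

type_synonym 'c dart = "'c \<times> 4"

record ('c, 'l) diagram =
  classical :: "'c set"
  virtual :: "'c set"
  opp_end :: "'c dart \<Rightarrow> 'c dart"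
  outgoing :: "'c dart set"
  loops :: "'l set"

definition darts :: "('c, 'l) diagram \<Rightarrow> 'c dart set" where
  "darts L = (classical L \<union> virtual L) \<times> UNIV"

definition graph_components :: "('c, 'l) diagram \<Rightarrow> 'c dart set set" where
  "graph_components L =
     components (darts L)
       ({(x, opp_end L x) | x. x \<in> darts L} \<union>
        {((c, i), (c, i + 1)) | c i. (c, i) \<in> darts L})"

definition faces :: "('c, 'l) diagram \<Rightarrow> 'c dart set set" where
  "faces L =
     components (darts L)
       {(x, y) | x y. x \<in> darts L \<and> y = (let (c, i) = opp_end L x in (c, i + 1))}"

text \<open>
  With \<open>V\<close> double points there are \<open>2V\<close> arcs, so Euler's formula \<open>V - E + F = 2 K\<close>, where
  each of the \<open>K\<close> components of the graph is put on a sphere of its own and \<open>F\<close> is the total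
  number of faces, reads \<open>F = V + 2 K\<close>. It holds iff each component has genus 0.
\<close>

definition planar :: "('c, 'l) diagram \<Rightarrow> bool" where
  "planar L \<longleftrightarrow>
     card (faces L) = card (classical L \<union> virtual L) + 2 * card (graph_components L)"

definition oriented_virtual_link_diagram :: "('c, 'l) diagram \<Rightarrow> bool" where
  "oriented_virtual_link_diagram L \<longleftrightarrow>
     finite (classical L) \<and> finite (virtual L) \<and> finite (loops L) \<and>
     classical L \<inter> virtual L = {} \<and>
     outgoing L \<subseteq> darts L \<and>
     (\<forall>x\<in>darts L. opp_end L x \<in> darts L \<and> opp_end L (opp_end L x) = x \<and>
        (opp_end L x \<in> outgoing L \<longleftrightarrow> x \<notin> outgoing L)) \<and>
     (\<forall>(c, i)\<in>darts L. (c, i + 2) \<in> outgoing L \<longleftrightarrow> (c, i) \<notin> outgoing L) \<and>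
     planar L"


section \<open>States and the Kauffman bracket\<close>

datatype splitting = A_splitting | B_splitting

text \<open>
  Rotating the overcrossing branch \<open>{0, 2}\<close> counterclockwise sweeps out the angles between
  \<open>0\<close> and \<open>1\<close> and between \<open>2\<close> and \<open>3\<close>. Joining these two angles leaves the
  branches \<open>{1, 2}\<close> and \<open>{3, 0}\<close>.
\<close>

fun split_end :: "splitting \<Rightarrow> 4 \<Rightarrow> 4" where
  "split_end A_splitting i = (if i = 0 \<or> i = 2 then i - 1 else i + 1)"
| "split_end B_splitting i = (if i = 0 \<or> i = 2 then i + 1 else i - 1)"

definition states :: "('c, 'l) diagram \<Rightarrow> ('c \<Rightarrow> splitting) set" where
  "states L = classical L \<rightarrow>\<^sub>E UNIV"

definition turn :: "('c, 'l) diagram \<Rightarrow> ('c \<Rightarrow> splitting) \<Rightarrow> 'c dart \<Rightarrow> 'c dart" where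
  "turn L S = (\<lambda>(c, i). (c, if c \<in> classical L then split_end (S c) i else i + 2))"

definition state_curves :: "('c, 'l) diagram \<Rightarrow> ('c \<Rightarrow> splitting) \<Rightarrow> ('c dart + 'l) set set" where
  "state_curves L S =
     components (darts L <+> loops L)
       ({(Inl x, Inl (opp_end L x)) | x. x \<in> darts L} \<union>
        {(Inl x, Inl (turn L S x)) | x. x \<in> darts L})"

definition alpha :: "('c, 'l) diagram \<Rightarrow> ('c \<Rightarrow> splitting) \<Rightarrow> nat" where
  "alpha L S = card {c \<in> classical L. S c = A_splitting}"

definition beta :: "('c, 'l) diagram \<Rightarrow> ('c \<Rightarrow> splitting) \<Rightarrow> nat" where
  "beta L S = card {c \<in> classical L. S c = B_splitting}"

definition delta :: "('c, 'l) diagram \<Rightarrow> ('c \<Rightarrow> splitting) \<Rightarrow> nat" where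
  "delta L S = card (state_curves L S)"

definition kauffman_bracket :: "('c, 'l) diagram \<Rightarrow> laurent" where
  "kauffman_bracket L =
     (\<Sum>S\<in>states L. monom3 (of_nat (alpha L S)) (of_nat (beta L S)) (of_nat (delta L S) - 1))"


section \<open>The ribbon graph of the Seifert state\<close>

definition preserves_orientation :: "('c, 'l) diagram \<Rightarrow> 'c \<Rightarrow> splitting \<Rightarrow> bool" where
  "preserves_orientation L c s \<longleftrightarrow>
     (\<forall>i. (c, split_end s i) \<in> outgoing L \<longleftrightarrow> (c, i) \<notin> outgoing L)"

definition seifert_state :: "('c, 'l) diagram \<Rightarrow> 'c \<Rightarrow> splitting" where
  "seifert_state L = (\<lambda>c\<in>classical L. THE s. preserves_orientation L c s)"

text \<open>
  The oriented Seifert circles are subdivided at the ends of the arcs of the diagram. The piece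
  starting at an outgoing end is an arc of the diagram. The piece starting at an incoming
  end \<open>(c, i)\<close> passes the double point \<open>c\<close>; if \<open>c\<close> is classical, it is one of the two
  branches of the splitting, and the band of \<open>c\<close> is glued to it.
\<close>

fun seifert_next :: "('c, 'l) diagram \<Rightarrow> 'c dart + 'l \<Rightarrow> 'c dart + 'l" where
  "seifert_next L (Inl x) =
     Inl (if x \<in> outgoing L then opp_end L x else turn L (seifert_state L) x)"
| "seifert_next L (Inr l) = Inr l"

definition incoming_over :: "('c, 'l) diagram \<Rightarrow> 'c \<Rightarrow> 'c dart" where
  "incoming_over L c = (c, if (c, 0) \<in> outgoing L then 2 else 0)"

definition incoming_under :: "('c, 'l) diagram \<Rightarrow> 'c \<Rightarrow> 'c dart" where
  "incoming_under L c = (c, if (c, 1) \<in> outgoing L then 3 else 1)"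

definition seifert_graph :: "('c, 'l) diagram \<Rightarrow> ('c dart + 'l, 'c) ribbon_graph" where
  "seifert_graph L =
     \<lparr> arcs = darts L <+> loops L,
       next_arc = seifert_next L,
       edges = classical L,
       attach = (\<lambda>c b. Inl (if b then incoming_under L c else incoming_over L c)),
       coherent = (\<lambda>c. True),
       edge_sign = (\<lambda>c. if seifert_state L c = A_splitting then 1 else -1) \<rparr>"


subsection \<open>Well-formedness\<close>

lemma four_cases: obtains "(i::4) = 0" | "i = 1" | "i = 2" | "i = 3"
proof (induct i)
  case (of_int z)
  then have "z = 0 \<or> z = 1 \<or> z = 2 \<or> z = 3" by auto
  with of_int show ?case by auto
qed

lemma wrap4: "(4::4) = 0" "(- 1::4) = 3"
  by simp_all

lemma all4: "(\<forall>i::4. P i) \<longleftrightarrow> P 0 \<and> P 1 \<and> P 2 \<and> P 3"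
  by (metis four_cases)

lemma seifert_state_preserves:
  assumes "oriented_virtual_link_diagram L" "c \<in> classical L"
  shows "preserves_orientation L c (seifert_state L c)"
proof -
  have st: "(c, i + 2) \<in> outgoing L \<longleftrightarrow> (c, i) \<notin> outgoing L" for i
    using assms by (auto simp: oriented_virtual_link_diagram_def darts_def)
  have s: "(c, 2) \<in> outgoing L \<longleftrightarrow> (c, 0) \<notin> outgoing L" "(c, 3) \<in> outgoing L \<longleftrightarrow> (c, 1) \<notin> outgoing L"
    using st[of 0] st[of 1] by simp_all
  have A: "preserves_orientation L c A_splitting \<longleftrightarrow> ((c, 0) \<in> outgoing L \<longleftrightarrow> (c, 1) \<in> outgoing L)"
    unfolding preserves_orientation_def all4 by (simp add: s wrap4) blast
  have B: "preserves_orientation L c B_splitting \<longleftrightarrow> ((c, 0) \<in> outgoing L \<longleftrightarrow> (c, 1) \<notin> outgoing L)"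
    unfolding preserves_orientation_def all4 by (simp add: s wrap4) blast
  have "\<exists>!s. preserves_orientation L c s"
  proof (cases "preserves_orientation L c A_splitting")
    case True
    then have "s = A_splitting" if "preserves_orientation L c s" for s
      using that A B by (cases s) simp_all
    with True show ?thesis by (rule ex1I)
  next
    case False
    then have "preserves_orientation L c B_splitting" using A B by simp
    moreover have "s = B_splitting" if "preserves_orientation L c s" for s
      using that False by (cases s) simp_all
    ultimately show ?thesis by (rule ex1I)
  qed
  from theI'[OF this] show ?thesis using assms by (simp add: seifert_state_def)
qed

lemma split_end_invol: "split_end s (split_end s i) = i"
  by (cases s; cases i rule: four_cases) simp_all

lemma turn_invol: "turn L S (turn L S x) = x"
proof -
  have "(i::4) + 2 + 2 = i" for i by (cases i rule: four_cases) simp_all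
  then show ?thesis by (cases x) (simp add: turn_def split_end_invol del: split_end.simps)
qed

lemma turn_dart: "x \<in> darts L \<Longrightarrow> turn L S x \<in> darts L"
  by (auto simp: turn_def darts_def)

lemma turn_outgoing:
  assumes "oriented_virtual_link_diagram L" "x \<in> darts L"
  shows "turn L (seifert_state L) x \<in> outgoing L \<longleftrightarrow> x \<notin> outgoing L"
proof (cases x)
  case (Pair c i)
  show ?thesis
  proof (cases "c \<in> classical L")
    case True
    with seifert_state_preserves[OF assms(1) True] show ?thesis
      by (simp add: turn_def Pair preserves_orientation_def)
  next
    case False
    with assms show ?thesis
      by (auto simp: turn_def Pair oriented_virtual_link_diagram_def)
  qed
qed

lemma signed_ribbon_graph_seifert_graph:
  assumes L: "oriented_virtual_link_diagram L"
  shows "signed_ribbon_graph (seifert_graph L)"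
proof -
  let ?G = "seifert_graph L"
  have fin: "finite (darts L)" "finite (classical L)" "finite (loops L)"
    using L by (simp_all add: oriented_virtual_link_diagram_def darts_def)
  have opp: "opp_end L x \<in> darts L" "opp_end L (opp_end L x) = x"
       "opp_end L x \<in> outgoing L \<longleftrightarrow> x \<notin> outgoing L" if "x \<in> darts L" for x
    using L that unfolding oriented_virtual_link_diagram_def by blast+
  note to = turn_outgoing[OF L]
  have st: "(c, i + 2) \<in> outgoing L \<longleftrightarrow> (c, i) \<notin> outgoing L" if "c \<in> classical L" for c i
  proof -
    have "(c, i) \<in> darts L" using that by (simp add: darts_def)
    then show ?thesis using L unfolding oriented_virtual_link_diagram_def by blast
  qed
  have inc: "incoming_over L c \<in> darts L - outgoing L" "incoming_under L c \<in> darts L - outgoing L"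
    if "c \<in> classical L" for c
    using st[OF that, of 0] st[OF that, of 1] that
    by (auto simp: incoming_over_def incoming_under_def darts_def)
  have inj: "inj_on (seifert_next L) (darts L <+> loops L)"
  proof (rule inj_onI)
    fix x y assume xy: "x \<in> darts L <+> loops L" "y \<in> darts L <+> loops L"
      "seifert_next L x = seifert_next L y"
    show "x = y"
    proof (cases x)
      case (Inr l) then show ?thesis using xy by (cases y) auto
    next
      case (Inl u)
      then obtain w where w: "y = Inl w" using xy by (cases y) auto
      have d: "u \<in> darts L" "w \<in> darts L" using xy Inl w by auto
      let ?t = "turn L (seifert_state L)"
      have eq: "(if u \<in> outgoing L then opp_end L u else ?t u) =
                (if w \<in> outgoing L then opp_end L w else ?t w)"
        using xy(3) by (simp add: Inl w)
      have "u \<in> outgoing L \<longleftrightarrow> w \<in> outgoing L"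
        using arg_cong[OF eq, of "\<lambda>x. x \<in> outgoing L"] d
        by (simp add: opp(3) to split: if_splits)
      then have "opp_end L u = opp_end L w \<or> ?t u = ?t w"
        using eq by (cases "u \<in> outgoing L") simp_all
      then have "opp_end L (opp_end L u) = opp_end L (opp_end L w) \<or> ?t (?t u) = ?t (?t w)"
        by auto
      then show ?thesis
        by (simp add: opp(2) d turn_invol Inl w)
    qed
  qed
  have sub: "seifert_next L ` (darts L <+> loops L) \<subseteq> darts L <+> loops L"
    by (auto simp: opp turn_dart)
  have bij: "bij_betw (next_arc ?G) (arcs ?G) (arcs ?G)"
    using inj sub fin endo_inj_surj[OF _ sub inj]
    by (simp add: seifert_graph_def bij_betw_def)
  have att: "attached_arcs ?G \<subseteq> Inl ` (darts L - outgoing L)"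
    using inc by (auto simp: attached_arcs_def seifert_graph_def)
  have nxt: "\<forall>a\<in>attached_arcs ?G. next_arc ?G a \<notin> attached_arcs ?G"
  proof
    fix a assume "a \<in> attached_arcs ?G"
    then obtain x where x: "a = Inl x" "x \<in> darts L" "x \<notin> outgoing L" using att by blast
    then have "next_arc ?G a = Inl (turn L (seifert_state L) x)" by (simp add: seifert_graph_def)
    with to[OF x(2)] x(3) att show "next_arc ?G a \<notin> attached_arcs ?G" by auto
  qed
  have injatt: "inj_on (\<lambda>(e, b). attach ?G e b) (edges ?G \<times> UNIV)"
    by (auto simp: inj_on_def seifert_graph_def incoming_over_def incoming_under_def split: if_splits)
  show ?thesis unfolding signed_ribbon_graph_def
    using bij att nxt injatt fin by (auto simp: seifert_graph_def)
qed

end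

theory Submission
  imports Defs
begin

text \<open>
  A state is determined by the set \<open>E\<close> of classical crossings at which it differs from the
  Seifert state, and \<open>E\<close> in turn determines the spanning subgraph \<open>F\<close> of the Seifert graph with
  edge set \<open>E\<close>. The theorem holds because this bijection matches the two sums term by term.

  The geometric content is that the state curves are the boundary circles of \<open>F\<close>
  (\<open>state_curves_eq_boundary_components\<close>). Where the band of a crossing is absent, the boundary
  of \<open>F\<close> follows the two branches of the Seifert splitting. Where the band is present, the boundary
  follows the two long sides of the band instead. As the band is glued coherently, one side joins
  the two incoming ends of the crossing and the other joins the two outgoing ends; this is exactly
  how the other splitting, the one that does not respect the orientation, joins the four ends.

  The rest is a count of exponents. With \<open>r(F) + k(F) = v(F) = v(G)\<close> and \<open>r(F) + n(F) = e(F)\<close>,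
  the term of \<open>F\<close> on the right-hand side has exponents
  \<open>n(G) + r(G) - r(F) - n(F) + 2 s(F) = e(G) - e(F) + 2 s(F)\<close> of \<open>A\<close>,
  \<open>e(F) - 2 s(F)\<close> of \<open>B\<close> and \<open>bc(F) - 1\<close> of \<open>d\<close>. The state has an \<open>A\<close>-splitting at the positive
  edges outside \<open>F\<close> and at the negative edges of \<open>F\<close>, so the first two numbers
  are \<open>\<alpha>\<close> and \<open>\<beta>\<close>.
\<close>

section \<open>Substitution of monomials\<close>

lemma subst_monomials_superset:
  assumes "finite K" "Poly_Mapping.keys P \<subseteq> K"
  shows "subst_monomials X Y Z P =
    (\<Sum>(p, q, t)\<in>K. Poly_Mapping.single (scale_exponent p X + scale_exponent q Y + scale_exponent t Z)
          (Poly_Mapping.lookup P (p, q, t)))"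
  unfolding subst_monomials_def
  by (rule sum.mono_neutral_left) (use assms in \<open>auto simp: in_keys_iff\<close>)

lemma subst_monomials_add:
  "subst_monomials X Y Z (P + Q) = subst_monomials X Y Z P + subst_monomials X Y Z Q"
proof -
  let ?K = "Poly_Mapping.keys P \<union> Poly_Mapping.keys Q"
  have K: "finite ?K" "Poly_Mapping.keys (P + Q) \<subseteq> ?K"
    "Poly_Mapping.keys P \<subseteq> ?K" "Poly_Mapping.keys Q \<subseteq> ?K"
    using Poly_Mapping.keys_add[of P Q] by auto
  show ?thesis
    unfolding subst_monomials_superset[OF K(1) K(2)] subst_monomials_superset[OF K(1) K(3)]
      subst_monomials_superset[OF K(1) K(4)]
    by (simp add: sum.distrib[symmetric] lookup_add single_add case_prod_beta)
qed

lemma subst_monomials_monom3: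
  "subst_monomials X Y Z (monom3 p q t) =
     Poly_Mapping.single (scale_exponent p X + scale_exponent q Y + scale_exponent t Z) 1"
  by (simp add: subst_monomials_def monom3_def)

lemma subst_monomials_sum:
  "subst_monomials X Y Z (\<Sum>i\<in>I. f i) = (\<Sum>i\<in>I. subst_monomials X Y Z (f i))"
proof (induction I rule: infinite_finite_induct)
  case (insert i I)
  then show ?case by (simp add: subst_monomials_add)
qed (simp_all add: subst_monomials_def)


section \<open>States as sets of crossings\<close>

fun other_splitting :: "splitting \<Rightarrow> splitting" where
  "other_splitting A_splitting = B_splitting"
| "other_splitting B_splitting = A_splitting"

lemma other_splitting_iff: "other_splitting s = t \<longleftrightarrow> s \<noteq> t"
  by (cases s; cases t) simp_all

definition switched_state :: "('c, 'l) diagram \<Rightarrow> 'c set \<Rightarrow> 'c \<Rightarrow> splitting" where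
  "switched_state L E =
     (\<lambda>c\<in>classical L. if c \<in> E then other_splitting (seifert_state L c) else seifert_state L c)"

lemma bij_betw_switched_state:
  "bij_betw (switched_state L) (Pow (classical L)) (states L)"
proof (rule bij_betw_byWitness)
  let ?f = "\<lambda>S. {c \<in> classical L. S c \<noteq> seifert_state L c}"
  show "\<forall>E\<in>Pow (classical L). ?f (switched_state L E) = E"
    by (auto simp: switched_state_def other_splitting_iff split: if_splits)
  show "\<forall>S\<in>states L. switched_state L (?f S) = S"
  proof
    fix S assume S: "S \<in> states L"
    show "switched_state L (?f S) = S"
    proof
      fix c show "switched_state L (?f S) c = S c"
        using PiE_arb[of S "classical L" "\<lambda>_. UNIV" c] S
        by (cases "c \<in> classical L") (simp_all add: switched_state_def other_splitting_iff states_def)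
    qed
  qed
  show "switched_state L ` Pow (classical L) \<subseteq> states L"
    by (auto simp: switched_state_def states_def)
qed auto

lemma card_split_by_membership:
  assumes "finite C" "E \<subseteq> C"
  shows "card {c \<in> C. if c \<in> E then P c else Q c} = card {c \<in> E. P c} + card {c \<in> C - E. Q c}"
proof -
  have "{c \<in> C. if c \<in> E then P c else Q c} = {c \<in> E. P c} \<union> {c \<in> C - E. Q c}"
    using assms(2) by auto
  moreover have "card ({c \<in> E. P c} \<union> {c \<in> C - E. Q c}) = card {c \<in> E. P c} + card {c \<in> C - E. Q c}"
    using assms by (intro card_Un_disjoint) (auto intro: finite_subset)
  ultimately show ?thesis by simp
qed

lemma alpha_switched_state:
  assumes "finite (classical L)" "E \<subseteq> classical L"
  shows "alpha L (switched_state L E) =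
    card {c \<in> E. seifert_state L c \<noteq> A_splitting} +
    card {c \<in> classical L - E. seifert_state L c = A_splitting}"
  unfolding alpha_def card_split_by_membership[OF assms, symmetric]
  by (rule arg_cong[where f = card]) (auto simp: switched_state_def other_splitting_iff)

lemma beta_switched_state:
  assumes "finite (classical L)" "E \<subseteq> classical L"
  shows "beta L (switched_state L E) =
    card {c \<in> E. seifert_state L c = A_splitting} +
    card {c \<in> classical L - E. seifert_state L c \<noteq> A_splitting}"
proof -
  have "x \<noteq> B_splitting \<longleftrightarrow> x = A_splitting" for x by (cases x) simp_all
  then show ?thesis
    unfolding beta_def card_split_by_membership[OF assms, symmetric]
    by (intro arg_cong[where f = card]) (auto simp: switched_state_def other_splitting_iff)
qed


section \<open>State curves as boundary circles\<close>

lemma components_cong: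
  assumes "R \<subseteq> (R' \<union> R'\<inverse>)\<^sup>*" "R' \<subseteq> (R \<union> R\<inverse>)\<^sup>*"
  shows "components X R = components X R'"
proof -
  have sub: "(R \<union> R\<inverse>)\<^sup>* \<subseteq> (R' \<union> R'\<inverse>)\<^sup>*" if "R \<subseteq> (R' \<union> R'\<inverse>)\<^sup>*" for R R' :: "('a \<times> 'a) set"
  proof -
    have "sym ((R' \<union> R'\<inverse>)\<^sup>*)" by (intro sym_rtrancl sym_Un_converse)
    then have "R \<union> R\<inverse> \<subseteq> (R' \<union> R'\<inverse>)\<^sup>*" using that by (auto dest: symD)
    then show ?thesis by (rule rtrancl_subset_rtrancl)
  qed
  show ?thesis using sub[OF assms(1)] sub[OF assms(2)] by (simp add: components_def)
qed

text \<open>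
  The other splitting of a crossing joins the two incoming ends, and it joins the two outgoing
  ends. The latter are written as the ends of the Seifert branches that start at the incoming
  ends, since this is how the sides of the band are named in the ribbon graph.
\<close>

lemma other_splitting_joins:
  assumes L: "oriented_virtual_link_diagram L" and c: "c \<in> classical L"
    and S: "S c = other_splitting (seifert_state L c)"
  defines "T \<equiv> turn L (seifert_state L)"
  shows "turn L S (incoming_over L c) = incoming_under L c"
    and "turn L S (incoming_under L c) = incoming_over L c"
    and "turn L S (T (incoming_over L c)) = T (incoming_under L c)"
    and "turn L S (T (incoming_under L c)) = T (incoming_over L c)"
proof -
  have "preserves_orientation L c (seifert_state L c)"
    by (rule seifert_state_preserves[OF L c])
  then have *: "(c, split_end (seifert_state L c) i) \<in> outgoing L \<longleftrightarrow> (c, i) \<notin> outgoing L" for i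
    unfolding preserves_orientation_def by blast
  have st: "(c, i + 2) \<in> outgoing L \<longleftrightarrow> (c, i) \<notin> outgoing L" for i
    using L c by (auto simp: oriented_virtual_link_diagram_def darts_def)
  have "turn L S (incoming_over L c) = incoming_under L c \<and>
    turn L S (incoming_under L c) = incoming_over L c \<and>
    turn L S (T (incoming_over L c)) = T (incoming_under L c) \<and>
    turn L S (T (incoming_under L c)) = T (incoming_over L c)"
    using *[of 0] *[of 1] st[of 0] st[of 1] S c
    by (cases "seifert_state L c")
       (auto simp: T_def turn_def incoming_over_def incoming_under_def wrap4)
  then show "turn L S (incoming_over L c) = incoming_under L c"
    "turn L S (incoming_under L c) = incoming_over L c"
    "turn L S (T (incoming_over L c)) = T (incoming_under L c)"
    "turn L S (T (incoming_under L c)) = T (incoming_over L c)" by blast+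
qed

lemma incoming_ends:
  assumes L: "oriented_virtual_link_diagram L" and c: "c \<in> classical L"
  shows "(c, i) \<notin> outgoing L \<longleftrightarrow> (c, i) = incoming_over L c \<or> (c, i) = incoming_under L c"
proof -
  have st: "(c, i + 2) \<in> outgoing L \<longleftrightarrow> (c, i) \<notin> outgoing L" for i
    using assms by (auto simp: oriented_virtual_link_diagram_def darts_def)
  show ?thesis using st[of 0] st[of 1]
    by (cases i rule: four_cases) (auto simp: incoming_over_def incoming_under_def)
qed

lemma state_curves_eq_boundary_components:
  fixes L :: "('c, 'l) diagram"
  assumes L: "oriented_virtual_link_diagram L" and E: "E \<subseteq> classical L"
  defines "F \<equiv> seifert_graph L\<lparr>edges := E\<rparr>"
  shows "state_curves L (switched_state L E) = components (arcs F) (boundary_pieces F)"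
proof -
  define S where "S = switched_state L E"
  define T where "T = turn L (seifert_state L)"
  define R :: "('c dart + 'l) rel" where "R = {(Inl x, Inl (opp_end L x)) | x. x \<in> darts L} \<union>
        {(Inl x, Inl (turn L S x)) | x. x \<in> darts L}"
  let ?B = "boundary_pieces F"
  let ?o = "incoming_over L" and ?u = "incoming_under L"
  have opp: "opp_end L x \<in> darts L" "opp_end L (opp_end L x) = x"
       "opp_end L x \<in> outgoing L \<longleftrightarrow> x \<notin> outgoing L" if "x \<in> darts L" for x
    using L that unfolding oriented_virtual_link_diagram_def by blast+
  have T: "T x \<in> darts L" "T (T x) = x" "T x \<in> outgoing L \<longleftrightarrow> x \<notin> outgoing L" if "x \<in> darts L" for x
    using that turn_outgoing[OF L that] by (auto simp: T_def turn_dart turn_invol)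
  have same: "turn L S x = T x" if "fst x \<notin> E" for x
    using that by (cases x) (auto simp: T_def S_def turn_def switched_state_def)
  have sw: "S c = other_splitting (seifert_state L c)" if "c \<in> E" for c
    using that E by (auto simp: S_def switched_state_def)
  have join: "turn L S (?o c) = ?u c" "turn L S (?u c) = ?o c"
    "turn L S (T (?o c)) = T (?u c)" "turn L S (T (?u c)) = T (?o c)" if "c \<in> E" for c
    using other_splitting_joins[where S = S and c = c, OF L _ sw[OF that]] that E
    unfolding T_def by blast+
  have inc: "?o c \<in> darts L" "?u c \<in> darts L" "?o c \<notin> outgoing L" "?u c \<notin> outgoing L"
    if "c \<in> classical L" for c
    using that incoming_ends[OF L that] by (auto simp: incoming_over_def incoming_under_def darts_def)
  have fst_inc: "fst (?o c) = c" "fst (?u c) = c" for c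
    by (simp_all add: incoming_over_def incoming_under_def)
  have att: "Inl x \<in> attached_arcs F \<longleftrightarrow> fst x \<in> E \<and> x \<notin> outgoing L" for x
  proof -
    have "Inl x \<in> attached_arcs F \<longleftrightarrow> (\<exists>c\<in>E. x = ?o c \<or> x = ?u c)"
      by (auto simp: F_def attached_arcs_def seifert_graph_def UNIV_bool)
    also have "\<dots> \<longleftrightarrow> fst x \<in> E \<and> (x = ?o (fst x) \<or> x = ?u (fst x))"
      using fst_inc by metis
    also have "\<dots> \<longleftrightarrow> fst x \<in> E \<and> x \<notin> outgoing L"
      using incoming_ends[OF L, of "fst x" "snd x"] E by auto
    finally show ?thesis .
  qed
  have sides: "edge_sides F c = {(Inl (?o c), Inl (?u c)), (Inl (T (?o c)), Inl (T (?u c)))}"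
    if "c \<in> E" for c
    using that inc[of c] E by (auto simp: edge_sides_def F_def seifert_graph_def T_def)
  have free: "(Inl x, Inl (if x \<in> outgoing L then opp_end L x else T x)) \<in> ?B"
    if "x \<in> darts L" "fst x \<in> E \<Longrightarrow> x \<in> outgoing L" for x
  proof -
    have "Inl x \<in> arcs F - attached_arcs F" using that att by (auto simp: F_def seifert_graph_def)
    moreover have "next_arc F (Inl x) = Inl (if x \<in> outgoing L then opp_end L x else T x)"
      by (simp add: F_def seifert_graph_def T_def)
    ultimately show ?thesis unfolding boundary_pieces_def by fastforce
  qed
  have band: "(Inl (?o c), Inl (?u c)) \<in> ?B" "(Inl (T (?o c)), Inl (T (?u c))) \<in> ?B" if "c \<in> E" for c
    using sides[OF that] that by (auto simp: boundary_pieces_def F_def)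
  have "R \<subseteq> ?B \<union> ?B\<inverse>"
  proof -
    have "(Inl x, Inl (opp_end L x)) \<in> ?B \<union> ?B\<inverse>" if x: "x \<in> darts L" for x
      using free[of x] free[of "opp_end L x"] opp[OF x] x by (cases "x \<in> outgoing L") auto
    moreover have "(Inl x, Inl (turn L S x)) \<in> ?B \<union> ?B\<inverse>" if x: "x \<in> darts L" for x
    proof (cases "fst x \<in> E")
      case False
      have "fst (T x) = fst x" by (simp add: T_def turn_def case_prod_beta)
      then show ?thesis
        using free[of x] free[of "T x"] T[OF x] x False same[OF False]
        by (cases "x \<in> outgoing L") auto
    next
      case True
      \<comment> \<open>An outgoing end is reached by the Seifert branch from an incoming end, so all four ends
        of the crossing are covered.\<close>
      define c where "c = fst x"
      have c: "c \<in> E" "c \<in> classical L" using True E by (auto simp: c_def)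
      have "fst (T x) = c" by (simp add: T_def turn_def case_prod_beta c_def)
      then have "x \<in> {?o c, ?u c} \<or> T x \<in> {?o c, ?u c}"
        using incoming_ends[OF L c(2), of "snd x"] incoming_ends[OF L c(2), of "snd (T x)"] T(3)[OF x]
        by (metis c_def insertCI prod.collapse)
      then have "x \<in> {?o c, ?u c, T (?o c), T (?u c)}"
        using T(2)[OF x] by auto
      then show ?thesis using band[OF c(1)] join[OF c(1)] by auto
    qed
    ultimately show ?thesis unfolding R_def by blast
  qed
  moreover have "?B \<subseteq> (R \<union> R\<inverse>)\<^sup>*"
  proof -
    have R1: "(Inl x, Inl (opp_end L x)) \<in> R" "(Inl x, Inl (turn L S x)) \<in> R" if "x \<in> darts L" for x
      using that unfolding R_def by blast+
    have "(a, next_arc F a) \<in> (R \<union> R\<inverse>)\<^sup>*" if a: "a \<in> arcs F" "a \<notin> attached_arcs F" for a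
    proof (cases a)
      case (Inr l)
      then show ?thesis by (simp add: F_def seifert_graph_def)
    next
      case (Inl x)
      then have x: "x \<in> darts L" "fst x \<in> E \<Longrightarrow> x \<in> outgoing L"
        using a att by (auto simp: F_def seifert_graph_def)
      then have "(a, next_arc F a) \<in> R"
        using R1[OF x(1)] same[of x] x(2)
        by (cases "x \<in> outgoing L"; cases "fst x \<in> E") (simp_all add: Inl F_def seifert_graph_def T_def)
      then show ?thesis by blast
    qed
    moreover have "edge_sides F c \<subseteq> R" if c: "c \<in> E" for c
      using R1(2)[of "?o c"] R1(2)[of "T (?o c)"] join[OF c] inc[of c] T(1)[of "?o c"] c E
      by (auto simp: sides)
    moreover have "edges F = E" by (simp add: F_def)
    ultimately show ?thesis unfolding boundary_pieces_def by blast
  qed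
  ultimately have "components (darts L <+> loops L) R = components (darts L <+> loops L) ?B"
    by (intro components_cong) auto
  then show ?thesis
    by (simp add: state_curves_def R_def S_def F_def seifert_graph_def)
qed


section \<open>Comparison of the two sums\<close>

lemma vertices_update_edges [simp]: "vertices (G\<lparr>edges := E\<rparr>) = vertices G"
  by (simp add: vertices_def)

lemma sum_spanning_subgraphs:
  "(\<Sum>F\<in>spanning_subgraphs G. f F) = (\<Sum>E\<in>Pow (edges G). f (G\<lparr>edges := E\<rparr>))"
proof -
  have "spanning_subgraphs G = (\<lambda>E. G\<lparr>edges := E\<rparr>) ` Pow (edges G)"
    by (auto simp: spanning_subgraphs_def)
  moreover have "inj_on (\<lambda>E. G\<lparr>edges := E\<rparr>) (Pow (edges G))"
  proof (rule inj_onI)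
    fix E E' assume "G\<lparr>edges := E\<rparr> = G\<lparr>edges := E'\<rparr>"
    then have "edges (G\<lparr>edges := E\<rparr>) = edges (G\<lparr>edges := E'\<rparr>)" by (rule arg_cong)
    then show "E = E'" by simp
  qed
  ultimately show ?thesis by (simp add: sum.reindex)
qed

lemma state_monomial_eq_subgraph_monomial:
  assumes L: "oriented_virtual_link_diagram L" and E: "E \<subseteq> classical L"
  defines "G \<equiv> seifert_graph L"
  defines "F \<equiv> G\<lparr>edges := E\<rparr>"
  defines "S \<equiv> switched_state L E"
  shows "monom3 (of_nat (alpha L S)) (of_nat (beta L S)) (of_nat (delta L S) - 1) =
    monom3 (of_int (nullity G)) (of_int (rank G)) (of_int (num_components G - 1)) *
    subst_monomials (exp_A + exp_d - exp_B) (exp_B + exp_d - exp_A) (- exp_d)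
      (monom3 (of_int (rank G - rank F) + s_value G F)
               (of_int (nullity F) - s_value G F)
               (of_int (num_components F - bc F + nullity F)))"
proof -
  have fin: "finite (classical L)" using L by (simp add: oriented_virtual_link_diagram_def)
  let ?pos = "\<lambda>X. card {c \<in> X. seifert_state L c = A_splitting}"
  let ?neg = "\<lambda>X. card {c \<in> X. seifert_state L c \<noteq> A_splitting}"
  have split: "card X = ?pos X + ?neg X" if "X \<subseteq> classical L" for X
  proof -
    have "finite X" using that fin by (rule finite_subset)
    then have "card ({c \<in> X. seifert_state L c = A_splitting} \<union> {c \<in> X. seifert_state L c \<noteq> A_splitting}) =
        ?pos X + ?neg X"
      by (intro card_Un_disjoint) auto
    moreover have "{c \<in> X. seifert_state L c = A_splitting} \<union> {c \<in> X. seifert_state L c \<noteq> A_splitting} = X"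
      by auto
    ultimately show ?thesis by simp
  qed
  have "card (classical L) = card E + card (classical L - E)"
    using E fin by (metis card_Diff_subset card_mono finite_subset le_add_diff_inverse)
  then have cG: "card (classical L) = ?pos E + ?neg E + (?pos (classical L - E) + ?neg (classical L - E))"
    using split[OF E] split[of "classical L - E"] by auto
  have delta: "int (delta L S) = bc F"
    using state_curves_eq_boundary_components[OF L E]
    by (simp add: delta_def bc_def S_def F_def G_def)
  have s: "s_value G F = (of_nat (?neg E) - of_nat (?neg (classical L - E))) / 2"
  proof -
    have neg_sign: "(edge_sign G c = -1) = (seifert_state L c \<noteq> A_splitting)" for c
      by (simp add: G_def seifert_graph_def)
    show ?thesis
      by (simp add: s_value_def e_minus_def complement_subgraph_def F_def neg_sign)
         (simp add: G_def seifert_graph_def)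
  qed
  have rF: "rank F = int (card (vertices G)) - num_components F"
    and rG: "rank G = int (card (vertices G)) - num_components G"
    by (simp_all add: rank_def F_def)
  have nG: "nullity G = int (card (classical L)) - rank G" and nF: "nullity F = int (card E) - rank F"
    by (simp_all add: nullity_def F_def G_def seifert_graph_def)
  have d: "(of_nat (delta L S) :: rat) = of_int (bc F)" using delta by (metis of_int_of_nat_eq)
  show ?thesis
    unfolding subst_monomials_monom3 unfolding monom3_def
    by (simp add: mult_single exp_A_def exp_B_def exp_d_def scale_exponent_def d)
       (simp add: nG nF cG split[OF E] alpha_switched_state[OF fin E, folded S_def]
        beta_switched_state[OF fin E, folded S_def] s rF rG algebra_simps add_divide_distrib diff_divide_distrib)
qed

theorem theorem4p1:
  fixes L :: "('c, 'l) diagram"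
  assumes "oriented_virtual_link_diagram L"
  shows "kauffman_bracket L =
           monom3 (of_int (nullity (seifert_graph L)))
                  (of_int (rank (seifert_graph L)))
                  (of_int (num_components (seifert_graph L) - 1)) *
           subst_monomials (exp_A + exp_d - exp_B) (exp_B + exp_d - exp_A) (- exp_d)
             (BR_poly (seifert_graph L))"
proof -
  have "edges (seifert_graph L) = classical L" by (simp add: seifert_graph_def)
  then show ?thesis
    unfolding kauffman_bracket_def BR_poly_def sum_spanning_subgraphs subst_monomials_sum
      sum_distrib_left sum.reindex_bij_betw[OF bij_betw_switched_state, symmetric]
    using state_monomial_eq_subgraph_monomial[OF assms] by (intro sum.cong) auto
qed

end
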